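(* Let $G$ be a finite undirected graph (multiple edges and loops allowed) and $v\in V(G)$. Then the semilattice of idempotents of the inverse semigroup $\mathrm{Tisg}(G,v)$, with the order $e\le f$ if and only if $e=ef$, forms a graded lattice.
   Context: Graphs are finite and undirected and may have multiple edges and loops. For $X\subseteq V(G)$, $G[X]$ is the subgraph of $G$ induced by $X$. A $v$-rooted tree induced subgraph of $G$ is a subgraph $H$ with $H=G[V(T)]$ for some tree $T$ in $G$ rooted at $v$ (so $v\in V(T)$). $\mathrm{Tisg}(G,v)$ is the set of all graph isomorphisms $\varphi:H\to J$ (bijections on vertices and on edges preserving incidence) with $H,J$ $v$-rooted tree induced subgraphs of $G$ and $\varphi(v)=v$. For $\varphi,\psi\in\mathrm{Tisg}(G,v)$, let $C_{\psi\circ\varphi}$ be the subgraph of $G$ induced by the set of all vertices $u$ for which there is a path from $v$ to $u$ contained in both $\mathrm{Im}(\varphi)$ and $\mathrm{Dom}(\psi)$; the product $\psi\circ\varphi:\varphi^{-1}(C_{\psi\circ\varphi})\to\psi(C_{\psi\circ\varphi})$ is the restriction of "apply $\varphi$, then $\psi$" to $\varphi^{-1}(C_{\psi\circ\varphi})$. With this product $\mathrm{Tisg}(G,v)$ is an inverse semigroup. A finite lattice is graded if all its maximal chains have the same length. *)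

theory Defs
  imports "HOL-Library.Uprod" "HOL-Algebra.Lattice"
begin

section \<open>Finite undirected multigraphs\<close>

text \<open>The two ends of an edge form an unordered pair, with \<open>Upair a a\<close> for a loop. Values of
  \<open>ends\<close> outside \<open>edges\<close> carry no meaning.\<close>

record ('v, 'e) mgraph =
  verts :: "'v set"
  edges :: "'e set"
  ends  :: "'e \<Rightarrow> 'v uprod"

definition finite_graph :: "('v, 'e) mgraph \<Rightarrow> bool" where
  "finite_graph G \<longleftrightarrow> finite (verts G) \<and> finite (edges G) \<and>
     (\<forall>e \<in> edges G. set_uprod (ends G e) \<subseteq> verts G)"

definition incident :: "('v, 'e) mgraph \<Rightarrow> 'v \<Rightarrow> 'e \<Rightarrow> bool" where
  "incident G x e \<longleftrightarrow> x \<in> set_uprod (ends G e)"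

definition subgraph :: "('v, 'e) mgraph \<Rightarrow> ('v, 'e) mgraph \<Rightarrow> bool" where
  "subgraph T G \<longleftrightarrow> finite_graph T \<and> verts T \<subseteq> verts G \<and> edges T \<subseteq> edges G \<and>
     (\<forall>e \<in> edges T. ends T e = ends G e)"

definition induced :: "('v, 'e) mgraph \<Rightarrow> 'v set \<Rightarrow> ('v, 'e) mgraph" where
  "induced G X = \<lparr> verts = verts G \<inter> X,
                   edges = {e \<in> edges G. set_uprod (ends G e) \<subseteq> X},
                   ends = ends G \<rparr>"

text \<open>In \<open>walk G u p w\<close>, the list \<open>p\<close> holds the successive steps from \<open>u\<close> to \<open>w\<close>, each being the
  edge used together with the vertex it leads to.\<close>

fun walk :: "('v, 'e) mgraph \<Rightarrow> 'v \<Rightarrow> ('e \<times> 'v) list \<Rightarrow> 'v \<Rightarrow> bool" where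
  "walk G u [] w \<longleftrightarrow> u \<in> verts G \<and> u = w"
| "walk G u ((e, x) # p) w \<longleftrightarrow>
     u \<in> verts G \<and> e \<in> edges G \<and> ends G e = Upair u x \<and> walk G x p w"

definition path :: "('v, 'e) mgraph \<Rightarrow> 'v \<Rightarrow> ('e \<times> 'v) list \<Rightarrow> 'v \<Rightarrow> bool" where
  "path G u p w \<longleftrightarrow> walk G u p w \<and> distinct (u # map snd p)"

text \<open>Loops are cycles of length 1 and pairs of parallel edges give cycles of length 2;
  distinctness of the edges prevents traversing one edge back and forth.\<close>

definition cycle :: "('v, 'e) mgraph \<Rightarrow> 'v \<Rightarrow> ('e \<times> 'v) list \<Rightarrow> bool" where
  "cycle G u p \<longleftrightarrow> p \<noteq> [] \<and> walk G u p u \<and> distinct (map fst p) \<and> distinct (map snd p)"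

definition connected_graph :: "('v, 'e) mgraph \<Rightarrow> bool" where
  "connected_graph G \<longleftrightarrow> verts G \<noteq> {} \<and> (\<forall>u \<in> verts G. \<forall>w \<in> verts G. \<exists>p. path G u p w)"

definition tree :: "('v, 'e) mgraph \<Rightarrow> bool" where
  "tree T \<longleftrightarrow> finite_graph T \<and> connected_graph T \<and> (\<nexists>u p. cycle T u p)"

definition rooted_tree_induced_subgraph ::
    "('v, 'e) mgraph \<Rightarrow> 'v \<Rightarrow> ('v, 'e) mgraph \<Rightarrow> bool" where
  "rooted_tree_induced_subgraph G v H \<longleftrightarrow>
     (\<exists>T. subgraph T G \<and> tree T \<and> v \<in> verts T \<and> H = induced G (verts T))"


section \<open>Partial isomorphisms and their product\<close>

text \<open>An isomorphism between subgraphs of \<open>G\<close> is a pair of partial maps, on vertices and on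
  edges. Its domain and image subgraphs are recovered from \<open>dom\<close> and \<open>ran\<close>, so equality of
  such pairs includes equality of domains and of codomains.\<close>

record ('v, 'e) piso =
  vmap :: "'v \<rightharpoonup> 'v"
  emap :: "'e \<rightharpoonup> 'e"

definition Dom :: "('v, 'e) mgraph \<Rightarrow> ('v, 'e) piso \<Rightarrow> ('v, 'e) mgraph" where
  "Dom G \<phi> = \<lparr> verts = dom (vmap \<phi>), edges = dom (emap \<phi>), ends = ends G \<rparr>"

definition Im :: "('v, 'e) mgraph \<Rightarrow> ('v, 'e) piso \<Rightarrow> ('v, 'e) mgraph" where
  "Im G \<phi> = \<lparr> verts = ran (vmap \<phi>), edges = ran (emap \<phi>), ends = ends G \<rparr>"

definition graph_iso ::
    "('v, 'e) piso \<Rightarrow> ('v, 'e) mgraph \<Rightarrow> ('v, 'e) mgraph \<Rightarrow> bool" where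
  "graph_iso \<phi> H J \<longleftrightarrow>
     dom (vmap \<phi>) = verts H \<and> bij_betw (\<lambda>x. the (vmap \<phi> x)) (verts H) (verts J) \<and>
     dom (emap \<phi>) = edges H \<and> bij_betw (\<lambda>e. the (emap \<phi> e)) (edges H) (edges J) \<and>
     (\<forall>x \<in> verts H. \<forall>e \<in> edges H.
        incident H x e \<longleftrightarrow> incident J (the (vmap \<phi> x)) (the (emap \<phi> e)))"

definition Tisg :: "('v, 'e) mgraph \<Rightarrow> 'v \<Rightarrow> ('v, 'e) piso set" where
  "Tisg G v = {\<phi>. \<exists>H J. rooted_tree_induced_subgraph G v H \<and>
                        rooted_tree_induced_subgraph G v J \<and>
                        graph_iso \<phi> H J \<and> vmap \<phi> v = Some v}"

text \<open>\<open>meet_graph G v \<psi> \<phi>\<close> is the subgraph $C_{\psi\circ\varphi}$, and \<open>Tisg_mult G v \<psi> \<phi>\<close> is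
  the product $\psi\circ\varphi$ (first \<open>\<phi>\<close>, then \<open>\<psi>\<close>).\<close>

definition meet_graph ::
    "('v, 'e) mgraph \<Rightarrow> 'v \<Rightarrow> ('v, 'e) piso \<Rightarrow> ('v, 'e) piso \<Rightarrow> ('v, 'e) mgraph" where
  "meet_graph G v \<psi> \<phi> =
     induced G {u. \<exists>p. path (Im G \<phi>) v p u \<and> path (Dom G \<psi>) v p u}"

definition Tisg_mult ::
    "('v, 'e) mgraph \<Rightarrow> 'v \<Rightarrow> ('v, 'e) piso \<Rightarrow> ('v, 'e) piso \<Rightarrow> ('v, 'e) piso" where
  "Tisg_mult G v \<psi> \<phi> =
     \<lparr> vmap = (vmap \<psi> \<circ>\<^sub>m vmap \<phi>) |` {x. \<exists>y \<in> verts (meet_graph G v \<psi> \<phi>). vmap \<phi> x = Some y},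
       emap = (emap \<psi> \<circ>\<^sub>m emap \<phi>) |` {e. \<exists>f \<in> edges (meet_graph G v \<psi> \<phi>). emap \<phi> e = Some f} \<rparr>"

definition Tisg_idempotents :: "('v, 'e) mgraph \<Rightarrow> 'v \<Rightarrow> ('v, 'e) piso gorder" where
  "Tisg_idempotents G v =
     \<lparr> carrier = {e \<in> Tisg G v. Tisg_mult G v e e = e},
       eq = (=),
       le = (\<lambda>e f. e = Tisg_mult G v e f) \<rparr>"


section \<open>Graded lattices\<close>

text \<open>A chain of length \<open>n\<close> has \<open>n + 1\<close> elements.\<close>

definition graded_lattice :: "'a gorder \<Rightarrow> bool" where
  "graded_lattice L \<longleftrightarrow> lattice L \<and> finite (carrier L) \<and>
     (\<exists>n. \<forall>C. pred_on.maxchain (carrier L) (le L) C \<longrightarrow> card C = Suc n)"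

end

theory Submission
  imports Defs
begin

text \<open>An idempotent of \<open>Tisg G v\<close> is the identity on an induced subgraph, and it is determined by a
  vertex set \<open>X\<close> containing \<open>v\<close> for which \<open>G[X]\<close> is connected; conversely every such \<open>X\<close> arises,
  since a connected graph has a spanning tree. The product of the idempotents of \<open>X\<close> and \<open>Y\<close>
  is that of the component of \<open>v\<close> in \<open>X \<inter> Y\<close>, so the order is inclusion of vertex sets. Connected
  sets containing \<open>v\<close> are closed under union, and whenever \<open>X \<subset> Y\<close> are two of them, a walk leaving
  \<open>X\<close> inside \<open>Y\<close> gives a vertex of \<open>Y - X\<close> that can be added to \<open>X\<close>. Hence cardinalities increase
  by exactly one along a maximal chain.\<close>

section \<open>Walks, paths and adjacency\<close>

text \<open>As a relation it turns reachability into \<open>rtrancl\<close>, so monotonicity,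
  transitivity and induction on closures replace work on lists of steps.\<close>

definition adjacency :: "('v, 'e) mgraph \<Rightarrow> ('v \<times> 'v) set" where
  "adjacency H = {(a, b). a \<in> verts H \<and> b \<in> verts H \<and> (\<exists>e \<in> edges H. ends H e = Upair a b)}"

lemma sym_adjacency: "sym (adjacency H)"
  by (auto simp: adjacency_def sym_def) (metis Upair_inject)

lemma walk_start: "walk H u p w \<Longrightarrow> u \<in> verts H"
  by (induction H u p w rule: walk.induct) auto

lemma walk_end: "walk H u p w \<Longrightarrow> w \<in> verts H"
  by (induction p arbitrary: u) auto

lemma path_suffix:
  assumes "path H x p w" "u \<in> set (x # map snd p)"
  shows "\<exists>q. path H u q w"
  using assms
proof (induction p arbitrary: x)
  case Nil
  then show ?case by auto
next
  case (Cons s p)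
  obtain e y where s: "s = (e, y)" by force
  show ?case
  proof (cases "u = x")
    case True
    then show ?thesis using Cons.prems by blast
  next
    case False
    have "path H y p w" using Cons.prems(1) by (auto simp: s path_def)
    moreover have "u \<in> set (y # map snd p)" using Cons.prems(2) False by (auto simp: s)
    ultimately show ?thesis by (rule Cons.IH)
  qed
qed

text \<open>A step is prepended to a path; if its start already lies on that path, the suffix from
  there is taken instead.\<close>

lemma walk_imp_path: "walk H u p w \<Longrightarrow> \<exists>q. path H u q w"
proof (induction H u p w rule: walk.induct)
  case (1 H u w)
  then have "path H u [] w" by (auto simp: path_def)
  then show ?case by blast
next
  case (2 H u e x p w)
  then obtain q where q: "path H x q w" by auto
  show ?case
  proof (cases "u \<in> set (x # map snd q)")
    case True
    then show ?thesis using path_suffix[OF q] by blast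
  next
    case False
    then have "path H u ((e, x) # q) w" using 2 q by (auto simp: path_def)
    then show ?thesis by blast
  qed
qed

lemma walk_imp_rtrancl: "walk H u p w \<Longrightarrow> (u, w) \<in> (adjacency H)\<^sup>*"
proof (induction H u p w rule: walk.induct)
  case (2 H u e x p w)
  then have "(u, x) \<in> adjacency H" by (auto simp: adjacency_def intro: walk_start)
  then show ?case using 2 by (auto intro: converse_rtrancl_into_rtrancl)
qed auto

text \<open>Walks and paths join the same pairs. The membership \<open>u \<in> verts H\<close>
  appears because \<open>rtrancl\<close> is reflexive outside the graph too.\<close>

lemma path_iff_rtrancl:
  "(\<exists>p. path H u p w) \<longleftrightarrow> u \<in> verts H \<and> (u, w) \<in> (adjacency H)\<^sup>*"
proof
  show "\<exists>p. path H u p w \<Longrightarrow> u \<in> verts H \<and> (u, w) \<in> (adjacency H)\<^sup>*"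
    by (auto simp: path_def intro: walk_start walk_imp_rtrancl)
next
  assume "u \<in> verts H \<and> (u, w) \<in> (adjacency H)\<^sup>*"
  then have "(u, w) \<in> (adjacency H)\<^sup>*" "u \<in> verts H" by auto
  then have "\<exists>p. walk H u p w"
  proof (induction rule: converse_rtrancl_induct)
    case base
    then have "walk H w [] w" by simp
    then show ?case by blast
  next
    case (step y z)
    then obtain e p where "walk H z p w" "e \<in> edges H" "ends H e = Upair y z"
      by (auto simp: adjacency_def)
    then have "walk H y ((e, z) # p) w" using step.prems by simp
    then show ?case by blast
  qed
  then show "\<exists>p. path H u p w" using walk_imp_path by metis
qed

lemma connected_graph_iff:
  "connected_graph H \<longleftrightarrow>
     verts H \<noteq> {} \<and> (\<forall>u \<in> verts H. \<forall>w \<in> verts H. (u, w) \<in> (adjacency H)\<^sup>*)"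
  unfolding connected_graph_def path_iff_rtrancl by blast

text \<open>An edge lies in both induced subgraphs iff its ends lie in X \<inter> Y. This matches
  the product, which asks for one path lying in an image and a domain at once.\<close>

lemma walk_induced_Int:
  "walk (induced G X) u p w \<and> walk (induced G Y) u p w \<longleftrightarrow> walk (induced G (X \<inter> Y)) u p w"
proof (induction p arbitrary: u)
  case Nil
  then show ?case by (auto simp: induced_def)
next
  case (Cons s p)
  obtain e y where s: "s = (e, y)" by force
  show ?case unfolding s walk.simps Cons.IH[of y, symmetric] by (auto simp: induced_def)
qed

lemma path_induced_Int:
  "path (induced G X) u p w \<and> path (induced G Y) u p w \<longleftrightarrow> path (induced G (X \<inter> Y)) u p w"
  unfolding path_def using walk_induced_Int[of G X u p w Y] by blast


section \<open>Growing trees\<close>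

lemma tree_singleton: "tree \<lparr>verts = {v}, edges = {}, ends = f\<rparr>"
proof -
  have "\<not> cycle \<lparr>verts = {v}, edges = {}, ends = f\<rparr> u p" for u p
    by (cases p) (auto simp: cycle_def)
  then show ?thesis
    by (auto simp: tree_def finite_graph_def connected_graph_iff)
qed

text \<open>A walk changes sides of the cut \<open>{u} | V - {u}\<close> exactly when it uses the pendant edge.\<close>

lemma even_count_pendant_edge:
  assumes pendant: "\<And>f. f \<in> edges H \<Longrightarrow> u \<in> set_uprod (ends H f) \<longleftrightarrow> f = e"
    and "ends H e = Upair x u" "x \<noteq> u"
  shows "walk H a p b \<Longrightarrow> even (count_list (map fst p) e) \<longleftrightarrow> (a = u \<longleftrightarrow> b = u)"
proof (induction p arbitrary: a)
  case (Cons s p)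
  obtain f y where s: "s = (f, y)" by force
  have f: "f \<in> edges H" "ends H f = Upair a y" "walk H y p b" using Cons.prems by (auto simp: s)
  have "f = e \<longleftrightarrow> \<not> (a = u \<longleftrightarrow> y = u)"
  proof (cases "f = e")
    case True
    then show ?thesis using f assms(2,3) by (auto simp: Upair_inject)
  next
    case False
    then show ?thesis using pendant[OF f(1)] f(2) by auto
  qed
  then show ?case using Cons.IH[OF f(3)] by (auto simp: s)
qed auto

text \<open>Connectivity is routed through \<open>x\<close>. A cycle uses the pendant edge an even
  number of times, yet at most once, hence never, so it already lies in \<open>T\<close>.\<close>

lemma tree_add_leaf:
  assumes T: "tree T" and x: "x \<in> verts T" and u: "u \<notin> verts T" and e: "e \<notin> edges T"
  shows "tree \<lparr>verts = insert u (verts T), edges = insert e (edges T),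
               ends = (ends T)(e := Upair x u)\<rparr>" (is "tree ?T")
proof -
  have fin: "finite_graph T" and con: "connected_graph T" and acyc: "\<And>a p. \<not> cycle T a p"
    using T by (auto simp: tree_def)
  have fin': "finite_graph ?T" using fin x by (auto simp: finite_graph_def)
  have sub: "adjacency T \<subseteq> adjacency ?T" using e by (fastforce simp: adjacency_def)
  have xu: "(x, u) \<in> adjacency ?T" using x by (auto simp: adjacency_def)
  then have ux: "(u, x) \<in> adjacency ?T" using sym_adjacency by (metis symD)
  have to_x: "(a, x) \<in> (adjacency ?T)\<^sup>*" and from_x: "(x, a) \<in> (adjacency ?T)\<^sup>*"
    if "a \<in> verts ?T" for a
    using that con x ux xu rtrancl_mono[OF sub] by (auto simp: connected_graph_iff)
  have con': "connected_graph ?T"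
    unfolding connected_graph_iff using to_x from_x by (auto intro: rtrancl_trans)
  \<comment> \<open>Edges of \<open>T\<close> have both ends in \<open>T\<close>, so a walk starting
    there and avoiding \<open>e\<close> cannot leave.\<close>
  have walk_T: "walk T a p b"
    if "walk ?T a p b" "e \<notin> set (map fst p)" "a \<in> verts T" for a p b
    using that
  proof (induction p arbitrary: a)
    case (Cons s p)
    obtain f y where s: "s = (f, y)" by force
    have f: "f \<in> edges T" "ends T f = Upair a y" using Cons.prems by (auto simp: s)
    then have "y \<in> verts T" using fin by (auto simp: finite_graph_def)
    then show ?case using Cons f by (auto simp: s)
  qed auto
  have "\<not> cycle ?T a p" for a p
  proof
    assume cyc: "cycle ?T a p"
    then have w: "walk ?T a p a" and d: "distinct (map fst p)" and ne: "p \<noteq> []"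
      by (auto simp: cycle_def)
    \<comment> \<open>A closed walk starts and ends on the same side of the cut, so the right-hand
      side is trivially true.\<close>
    have "even (count_list (map fst p) e) \<longleftrightarrow> (a = u \<longleftrightarrow> a = u)"
      by (rule even_count_pendant_edge[OF _ _ _ w])
        (use fin u x in \<open>auto simp: finite_graph_def\<close>)
    moreover have "count_list es e = 1" if "distinct es" "e \<in> set es" for es
      using that by (induction es) auto
    ultimately have e_notin: "e \<notin> set (map fst p)"
      using d by (metis odd_one)
    \<comment> \<open>The base point could still be \<open>u\<close>; the first edge, being in
      \<open>T\<close>, excludes this.\<close>
    obtain f y q where p: "p = (f, y) # q" using ne by (metis list.exhaust surj_pair)
    have "f \<in> edges T" "ends T f = Upair a y" using w e_notin by (auto simp: p)
    then have "a \<in> verts T" using fin by (auto simp: finite_graph_def)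
    then have "cycle T a p" using walk_T[OF w e_notin] cyc by (auto simp: cycle_def)
    then show False using acyc by blast
  qed
  then show ?thesis using fin' con' by (auto simp: tree_def)
qed


section \<open>Partial identity maps\<close>

lemma dom_Some_restrict: "dom (Some |` X) = X"
  by (auto simp: restrict_map_def split: if_splits)

lemma ran_Some_restrict: "ran (Some |` X) = X"
  by (auto simp: ran_def restrict_map_def)

text \<open>If f x = y, idempotence gives f y = y, so x and y have the same image and coincide. The
  set \<open>S\<close> is arbitrary to cover both the vertex and the edge map.\<close>

lemma partial_idempotent_eq_id:
  assumes idem: "f = (f \<circ>\<^sub>m f) |` S"
    and inj: "inj_on (\<lambda>x. the (f x)) (dom f)"
  shows "f = Some |` dom f"
proof
  fix x
  show "f x = (Some |` dom f) x"
  proof (cases "f x")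
    case None
    then show ?thesis by (simp add: restrict_map_def dom_def)
  next
    case (Some y)
    then have "f y = Some y"
      using fun_cong[OF idem, of x] by (auto simp: restrict_map_def map_comp_def split: if_splits)
    then have "x = y" using inj Some by (auto simp: inj_on_def dom_def)
    then show ?thesis using Some by (simp add: restrict_map_def dom_def)
  qed
qed


section \<open>Connected vertex sets containing the root\<close>

locale rooted_graph =
  fixes G :: "('v, 'e) mgraph" and v :: 'v
  assumes fin: "finite_graph G" and root: "v \<in> verts G"
begin

text \<open>The component of v in G[Z], phrased with \<open>path\<close> as in
  \<open>meet_graph\<close>. It is empty when v is outside Z, hence the recurring assumption
  \<open>v \<in> Z\<close>.\<close>

definition component :: "'v set \<Rightarrow> 'v set" where
  "component Z = {u. \<exists>p. path (induced G Z) v p u}"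

text \<open>Connectedness of G[X] is expressed as a fixed point of \<open>component\<close>, so that
  monotonicity of \<open>component\<close> can be applied directly.\<close>

definition conn_sets :: "'v set set" where
  "conn_sets = {X. v \<in> X \<and> X \<subseteq> verts G \<and> component X = X}"

definition id_on :: "'v set \<Rightarrow> ('v, 'e) piso" where
  "id_on X = \<lparr>vmap = Some |` X, emap = Some |` edges (induced G X)\<rparr>"

lemma finite_verts: "finite (verts G)"
  using fin by (simp add: finite_graph_def)

lemma component_eq: "v \<in> Z \<Longrightarrow> component Z = {u. (v, u) \<in> (adjacency (induced G Z))\<^sup>*}"
  unfolding component_def path_iff_rtrancl using root by (auto simp: induced_def)

lemma component_subset: "component Z \<subseteq> verts G \<inter> Z"
  by (auto simp: component_def path_def induced_def dest!: walk_end)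

lemma adjacency_induced:
  "(a, b) \<in> adjacency (induced G Z) \<longleftrightarrow>
     a \<in> verts G \<inter> Z \<and> b \<in> verts G \<inter> Z \<and> (\<exists>e \<in> edges G. ends G e = Upair a b)"
  by (auto simp: adjacency_def induced_def)

lemma adjacency_mono: "X \<subseteq> Y \<Longrightarrow> adjacency (induced G X) \<subseteq> adjacency (induced G Y)"
  by (auto simp: adjacency_def induced_def)

lemma component_mono:
  assumes "X \<subseteq> Y" "v \<in> X"
  shows "component X \<subseteq> component Y"
  using assms rtrancl_mono[OF adjacency_mono[OF assms(1)]] component_eq[of X] component_eq[of Y]
  by blast

text \<open>Every vertex on a walk from v is itself reached from v, so the walk stays inside the
  component.\<close>

lemma component_in_conn_sets:
  assumes v: "v \<in> Z"
  shows "component Z \<in> conn_sets"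
proof -
  have v': "v \<in> component Z" using component_eq[OF v] by simp
  have "(v, u) \<in> (adjacency (induced G (component Z)))\<^sup>*"
    if "(v, u) \<in> (adjacency (induced G Z))\<^sup>*" for u
    using that
  proof (induction rule: rtrancl_induct)
    case (step y z)
    have "y \<in> component Z" "z \<in> component Z"
      using step component_eq[OF v] by (auto intro: rtrancl_into_rtrancl)
    then have "(y, z) \<in> adjacency (induced G (component Z))"
      using step(2) by (auto simp: adjacency_induced)
    then show ?case using step.IH by (rule rtrancl_into_rtrancl[rotated])
  qed simp
  then have "component Z \<subseteq> component (component Z)"
    using component_eq[OF v] component_eq[OF v'] by blast
  then show ?thesis using component_subset v' by (fastforce simp: conn_sets_def)
qed

lemma conn_setsI:
  assumes "v \<in> X" "X \<subseteq> verts G" "X \<subseteq> component X"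
  shows "X \<in> conn_sets"
  using assms component_subset[of X] by (auto simp: conn_sets_def)

text \<open>Monotonicity applied to W = \<open>component W\<close>. This later makes
  \<open>component (X \<inter> Y)\<close> the meet of X and Y.\<close>

lemma component_greatest:
  assumes "W \<in> conn_sets" "W \<subseteq> Z"
  shows "W \<subseteq> component Z"
  using assms component_mono[of W Z] by (auto simp: conn_sets_def)

lemma Un_in_conn_sets:
  assumes "X \<in> conn_sets" "Y \<in> conn_sets"
  shows "X \<union> Y \<in> conn_sets"
  using assms component_greatest[of X "X \<union> Y"] component_greatest[of Y "X \<union> Y"]
  by (intro conn_setsI) (auto simp: conn_sets_def)

lemma singleton_in_conn_sets: "{v} \<in> conn_sets"
  by (intro conn_setsI) (auto simp: root component_eq)

text \<open>Without such an edge, everything reachable from v in G[Y] would stay in X, although all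
  of Y is reachable.\<close>

lemma conn_sets_leaving_edge:
  assumes "v \<in> X" "X \<subset> Y" "Y \<in> conn_sets"
  obtains a b e where "a \<in> X" "b \<in> Y - X" "e \<in> edges G" "ends G e = Upair a b"
proof -
  have "\<exists>a \<in> X. \<exists>b. b \<notin> X \<and> (a, b) \<in> adjacency (induced G Y)"
  proof (rule ccontr)
    assume stay: "\<not> ?thesis"
    have "u \<in> X" if "(v, u) \<in> (adjacency (induced G Y))\<^sup>*" for u
      using that by (induction rule: rtrancl_induct) (use stay assms(1) in auto)
    moreover have "v \<in> Y" "component Y = Y" using assms by (auto simp: conn_sets_def)
    ultimately show False using component_eq[of Y] assms(2) by auto
  qed
  then show ?thesis using that by (auto simp: adjacency_induced)
qed

text \<open>The new vertex is reached through X and then along an edge leaving X. This one-vertex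
  growth is the source of gradedness.\<close>

lemma conn_sets_augment:
  assumes X: "X \<in> conn_sets" and Y: "Y \<in> conn_sets" and "X \<subset> Y"
  obtains b where "b \<in> Y - X" "insert b X \<in> conn_sets"
proof -
  have v: "v \<in> X" using X by (simp add: conn_sets_def)
  obtain a b e where *: "a \<in> X" "b \<in> Y - X" "e \<in> edges G" "ends G e = Upair a b"
    using conn_sets_leaving_edge[OF v assms(3) Y] .
  have V: "insert b X \<subseteq> verts G" using X Y * by (auto simp: conn_sets_def)
  have sub: "X \<subseteq> component (insert b X)" by (rule component_greatest[OF X]) auto
  have "(a, b) \<in> adjacency (induced G (insert b X))"
    using * V by (auto simp: adjacency_induced)
  then have "b \<in> component (insert b X)"
    using sub *(1) v component_eq[of "insert b X"] by (auto intro: rtrancl_into_rtrancl)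
  then have "insert b X \<in> conn_sets" using sub V v by (intro conn_setsI) auto
  then show ?thesis using that *(2) by blast
qed

section \<open>Trees and connected vertex sets\<close>

lemma verts_tree_in_conn_sets:
  assumes "subgraph T G" "tree T" "v \<in> verts T"
  shows "verts T \<in> conn_sets"
proof (rule conn_setsI)
  show V: "v \<in> verts T" "verts T \<subseteq> verts G" using assms by (auto simp: subgraph_def)
  have "adjacency T \<subseteq> adjacency (induced G (verts T))"
    unfolding subset_iff using assms(1)
    by (auto simp: adjacency_induced subgraph_def) (auto simp: adjacency_def)
  then have "(adjacency T)\<^sup>* \<subseteq> (adjacency (induced G (verts T)))\<^sup>*" by (rule rtrancl_mono)
  then show "verts T \<subseteq> component (verts T)"
    using assms(2,3) component_eq[OF V(1)] by (auto simp: tree_def connected_graph_iff)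
qed

text \<open>Starting from the single vertex v, leaves are added along leaving edges; the number of
  missing vertices decreases.\<close>

lemma spanning_tree:
  assumes Y: "Y \<in> conn_sets"
  shows "\<exists>T. subgraph T G \<and> tree T \<and> verts T = Y"
proof -
  have finY: "finite Y" using Y finite_verts by (auto simp: conn_sets_def intro: finite_subset)
  have extend: "\<exists>T'. subgraph T' G \<and> tree T' \<and> verts T' = Y"
    if "subgraph T G" "tree T" "v \<in> verts T" "verts T \<subseteq> Y" for T
    using that
  proof (induction "card (Y - verts T)" arbitrary: T rule: less_induct)
    case less
    show ?case
    proof (cases "verts T = Y")
      case True
      then show ?thesis using less.prems by blast
    next
      case False
      then obtain a b e where *: "a \<in> verts T" "b \<in> Y - verts T" "e \<in> edges G"
        "ends G e = Upair a b"
        using conn_sets_leaving_edge[of "verts T" Y] less.prems Y by blast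
      \<comment> \<open>The end \<open>b\<close> lies outside \<open>T\<close>, whereas edges of
        \<open>T\<close> have both ends inside.\<close>
      have e: "e \<notin> edges T"
        using * less.prems(1) by (auto simp: subgraph_def finite_graph_def)
      \<comment> \<open>\<open>ends T\<close> agrees with \<open>ends G\<close> only on
        \<open>edges T\<close>, so its value at \<open>e\<close> is set explicitly.\<close>
      let ?T = "\<lparr>verts = insert b (verts T), edges = insert e (edges T),
                 ends = (ends T)(e := Upair a b)\<rparr>"
      have tr: "tree ?T" using tree_add_leaf[OF less.prems(2) *(1) _ e] * by blast
      moreover have "subgraph ?T G"
        using tr less.prems(1) * Y by (auto simp: subgraph_def tree_def conn_sets_def)
      moreover have "card (Y - verts ?T) < card (Y - verts T)"
        using * finY by (intro psubset_card_mono) auto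
      ultimately show ?thesis using less.hyps[of ?T] less.prems * by auto
    qed
  qed
  let ?S = "\<lparr>verts = {v}, edges = {}, ends = ends G\<rparr>"
  show ?thesis
    by (rule extend[of ?S])
      (use Y root tree_singleton in \<open>auto simp: subgraph_def finite_graph_def conn_sets_def\<close>)
qed

lemma rooted_tree_induced_subgraph_iff:
  "rooted_tree_induced_subgraph G v H \<longleftrightarrow> (\<exists>X \<in> conn_sets. H = induced G X)"
  unfolding rooted_tree_induced_subgraph_def
proof
  assume "\<exists>T. subgraph T G \<and> tree T \<and> v \<in> verts T \<and> H = induced G (verts T)"
  then show "\<exists>X \<in> conn_sets. H = induced G X" using verts_tree_in_conn_sets by blast
next
  assume "\<exists>X \<in> conn_sets. H = induced G X"
  then obtain X where X: "X \<in> conn_sets" "H = induced G X" by blast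
  then obtain T where "subgraph T G" "tree T" "verts T = X" using spanning_tree by blast
  then show "\<exists>T. subgraph T G \<and> tree T \<and> v \<in> verts T \<and> H = induced G (verts T)"
    using X by (auto simp: conn_sets_def)
qed


section \<open>Idempotents\<close>

lemma verts_induced: "X \<in> conn_sets \<Longrightarrow> verts (induced G X) = X"
  by (auto simp: conn_sets_def induced_def)

lemma Dom_id_on: "X \<in> conn_sets \<Longrightarrow> Dom G (id_on X) = induced G X"
  using verts_induced[of X] by (simp add: Dom_def id_on_def dom_Some_restrict) (simp add: induced_def)

lemma Im_id_on: "X \<in> conn_sets \<Longrightarrow> Im G (id_on X) = induced G X"
  using verts_induced[of X] by (simp add: Im_def id_on_def ran_Some_restrict) (simp add: induced_def)

text \<open>A path in both G[Y] and G[X] is a path in G[X \<inter> Y], so the meet graph is induced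
  by the component of v there.\<close>

lemma Tisg_mult_id_on:
  assumes "X \<in> conn_sets" "Y \<in> conn_sets"
  shows "Tisg_mult G v (id_on X) (id_on Y) = id_on (component (X \<inter> Y))"
proof -
  have "meet_graph G v (id_on X) (id_on Y) = induced G (component (X \<inter> Y))"
    unfolding meet_graph_def Dom_id_on[OF assms(1)] Im_id_on[OF assms(2)] path_induced_Int
    by (simp add: component_def Int_commute)
  then show ?thesis
    using component_subset[of "X \<inter> Y"]
    by (auto simp: Tisg_mult_def id_on_def restrict_map_def map_comp_def induced_def fun_eq_iff)
qed

lemma id_on_eq_iff: "id_on X = id_on Y \<longleftrightarrow> X = Y"
proof
  assume "id_on X = id_on Y"
  then have "dom (vmap (id_on X)) = dom (vmap (id_on Y))" by simp
  then show "X = Y" by (simp add: id_on_def dom_Some_restrict)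
qed simp

lemma le_id_on_iff:
  assumes "X \<in> conn_sets" "Y \<in> conn_sets"
  shows "id_on X = Tisg_mult G v (id_on X) (id_on Y) \<longleftrightarrow> X \<subseteq> Y"
proof -
  have "X = component (X \<inter> Y) \<longleftrightarrow> X \<subseteq> Y"
    using assms(1) component_subset[of "X \<inter> Y"] by (auto simp: conn_sets_def Int_absorb2)
  then show ?thesis by (simp add: Tisg_mult_id_on[OF assms] id_on_eq_iff)
qed

lemma id_on_in_Tisg:
  assumes "X \<in> conn_sets"
  shows "id_on X \<in> Tisg G v"
proof -
  have "graph_iso (id_on X) (induced G X) (induced G X)"
    using verts_induced[OF assms]
    by (auto simp: graph_iso_def id_on_def dom_def restrict_map_def bij_betw_def inj_on_def)
  moreover have "vmap (id_on X) v = Some v" using assms by (simp add: id_on_def conn_sets_def)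
  ultimately show ?thesis
    using assms unfolding Tisg_def rooted_tree_induced_subgraph_iff by blast
qed

text \<open>Both maps are injective, so idempotence makes them partial identities; their domains are
  the vertices and edges of some G[X].\<close>

lemma idempotent_eq_id_on:
  assumes "\<phi> \<in> Tisg G v" and idem: "Tisg_mult G v \<phi> \<phi> = \<phi>"
  shows "\<exists>X \<in> conn_sets. \<phi> = id_on X"
proof -
  obtain X J where X: "X \<in> conn_sets" and iso: "graph_iso \<phi> (induced G X) J"
    using assms(1) unfolding Tisg_def rooted_tree_induced_subgraph_iff by auto
  have "vmap \<phi> = Some |` dom (vmap \<phi>)"
    using iso partial_idempotent_eq_id[OF sym[OF arg_cong[where f = vmap, OF idem,
        unfolded Tisg_mult_def piso.simps]]]
    by (simp add: graph_iso_def bij_betw_def)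
  moreover have "emap \<phi> = Some |` dom (emap \<phi>)"
    using iso partial_idempotent_eq_id[OF sym[OF arg_cong[where f = emap, OF idem,
        unfolded Tisg_mult_def piso.simps]]]
    by (simp add: graph_iso_def bij_betw_def)
  ultimately have "\<phi> = id_on X"
    using iso verts_induced[OF X] by (auto simp: graph_iso_def id_on_def intro: piso.equality)
  then show ?thesis using X by blast
qed

lemma carrier_idempotents: "carrier (Tisg_idempotents G v) = id_on ` conn_sets"
proof -
  have "Tisg_mult G v (id_on X) (id_on X) = id_on X" if "X \<in> conn_sets" for X
    using le_id_on_iff[OF that that] by simp
  then show ?thesis
    using idempotent_eq_id_on id_on_in_Tisg by (auto simp: Tisg_idempotents_def)
qed

section \<open>Order and lattice operations\<close>

lemma le_idempotents:
  assumes "X \<in> conn_sets" "Y \<in> conn_sets"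
  shows "id_on X \<sqsubseteq>\<^bsub>Tisg_idempotents G v\<^esub> id_on Y \<longleftrightarrow> X \<subseteq> Y"
  using le_id_on_iff[OF assms] by (simp add: Tisg_idempotents_def)

text \<open>Joins are unions. An intersection may be disconnected, so the meet is its component at
  v.\<close>

lemma lattice_idempotents: "lattice (Tisg_idempotents G v)"
proof -
  let ?L = "Tisg_idempotents G v"
  have eq: "x .=\<^bsub>?L\<^esub> y \<longleftrightarrow> x = y" for x y by (simp add: Tisg_idempotents_def)
  interpret partial_order ?L
    by unfold_locales (auto simp: eq carrier_idempotents le_idempotents fun_eq_iff)
  show ?thesis
  proof
    fix x y
    assume "x \<in> carrier ?L" "y \<in> carrier ?L"
    then obtain X Y where X: "x = id_on X" "X \<in> conn_sets" and Y: "y = id_on Y" "Y \<in> conn_sets"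
      by (auto simp: carrier_idempotents)
    have "v \<in> X \<inter> Y" using X Y by (simp add: conn_sets_def)
    note M = component_in_conn_sets[OF this]
    note J = Un_in_conn_sets[OF X(2) Y(2)]
    have "least ?L (id_on (X \<union> Y)) (Upper ?L {x, y})"
      using J X Y by (auto simp: least_def Upper_def carrier_idempotents le_idempotents)
    then show "\<exists>s. least ?L s (Upper ?L {x, y})" by blast
    have "greatest ?L (id_on (component (X \<inter> Y))) (Lower ?L {x, y})"
      using M X Y component_subset[of "X \<inter> Y"] component_greatest[of _ "X \<inter> Y"]
      by (auto simp: greatest_def Lower_def carrier_idempotents le_idempotents)
    then show "\<exists>s. greatest ?L s (Lower ?L {x, y})" by blast
  qed
qed

section \<open>Maximal chains\<close>

lemma finite_conn_sets: "finite conn_sets"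
  by (rule finite_subset[of _ "Pow (verts G)"]) (auto simp: conn_sets_def finite_verts)

text \<open>Cardinality maps C bijectively onto the interval from 1 to the size of the largest
  connected set, the component of v in G.\<close>

lemma card_maxchain_conn_sets:
  assumes "C \<subseteq> conn_sets"
    and chain: "\<And>X Y. X \<in> C \<Longrightarrow> Y \<in> C \<Longrightarrow> X \<subseteq> Y \<or> Y \<subseteq> X"
    and max: "\<And>Z. Z \<in> conn_sets \<Longrightarrow> (\<And>X. X \<in> C \<Longrightarrow> X \<subseteq> Z \<or> Z \<subseteq> X) \<Longrightarrow> Z \<in> C"
  shows "card C = card (component (verts G))"
proof -
  let ?B = "component (verts G)"
  have fin_set: "finite X" if "X \<in> conn_sets" for X
    using that finite_verts by (auto simp: conn_sets_def intro: finite_subset)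
  have finC: "finite C" using assms(1) finite_conn_sets by (rule finite_subset)
  have top: "X \<subseteq> ?B" if "X \<in> conn_sets" for X
    using component_greatest[OF that] that by (simp add: conn_sets_def)
  have B: "?B \<in> conn_sets" using component_in_conn_sets root .
  \<comment> \<open>The greatest and least connected sets are comparable with everything, so
    maximality puts them in C.\<close>
  have BC: "?B \<in> C" using max[OF B] top assms(1) by blast
  have bot: "{v} \<subseteq> X" if "X \<in> conn_sets" for X using that by (simp add: conn_sets_def)
  have vC: "{v} \<in> C" using max[OF singleton_in_conn_sets] bot assms(1) by blast
  have inj: "inj_on card C"
  proof (rule inj_onI)
    fix X Y
    assume "X \<in> C" "Y \<in> C" "card X = card Y"
    then show "X = Y"
      using chain[of X Y] fin_set assms(1) by (metis card_subset_eq subsetD)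
  qed
  \<comment> \<open>Climbing the chain from {v}, no size is skipped; sizes start at 1, hence
    \<open>Suc k\<close>.\<close>
  have "\<exists>X \<in> C. card X = Suc k" if "Suc k \<le> card ?B" for k
    using that
  proof (induction k)
    case 0
    then show ?case using vC by (intro bexI[of _ "{v}"]) auto
  next
    case (Suc k)
    then obtain X where X: "X \<in> C" "card X = Suc k" by auto
    then have "X \<noteq> ?B" using Suc.prems by auto
    then have "{Y \<in> C. X \<subset> Y} \<noteq> {}" using BC X(1) top assms(1) by blast
    \<comment> \<open>\<open>Y\<close> is the immediate successor of \<open>X\<close> in C.\<close>
    then obtain Y where Y: "Y \<in> C" "X \<subset> Y" and
      Ymin: "\<And>Z. Z \<in> C \<Longrightarrow> X \<subset> Z \<Longrightarrow> Z \<subseteq> Y \<Longrightarrow> Z = Y"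
      using finite_has_minimal[of "{Y \<in> C. X \<subset> Y}"] finC
      by (smt (verit) finite_subset mem_Collect_eq subsetI)
    obtain b where b: "b \<in> Y - X" "insert b X \<in> conn_sets"
      using conn_sets_augment[of X Y] X Y assms(1) by blast
    \<comment> \<open>\<open>insert b X\<close> lies between \<open>X\<close> and its successor
      \<open>Y\<close>: members of C either lie below \<open>X\<close> or contain
      \<open>Y\<close>.\<close>
    have "Z \<subseteq> insert b X \<or> insert b X \<subseteq> Z" if "Z \<in> C" for Z
    proof (cases "Z \<subseteq> X")
      case False
      then have "X \<subset> Z" using chain[OF X(1) that] by blast
      then have "Y \<subseteq> Z" using chain[OF Y(1) that] Ymin[OF that] by blast
      then show ?thesis using b(1) Y(2) by blast
    qed blast
    then have "insert b X \<in> C" by (rule max[OF b(2)])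
    moreover have "card (insert b X) = Suc (Suc k)"
      using b(1) X fin_set assms(1) by (metis DiffD2 card_insert_disjoint subsetD)
    ultimately show ?case by blast
  qed
  then have "{1..card ?B} \<subseteq> card ` C"
    by (smt (verit, ccfv_threshold) One_nat_def atLeastAtMost_iff imageI not0_implies_Suc
        not_one_le_zero subsetI)
  moreover have "card ` C \<subseteq> {1..card ?B}"
  proof
    fix n
    assume "n \<in> card ` C"
    then obtain X where X: "X \<in> conn_sets" "n = card X" using assms(1) by blast
    have "card {v} \<le> card X" by (rule card_mono[OF fin_set[OF X(1)] bot[OF X(1)]])
    moreover have "card X \<le> card ?B" by (rule card_mono[OF fin_set[OF B] top[OF X(1)]])
    ultimately show "n \<in> {1..card ?B}" using X(2) by simp
  qed
  ultimately have "card ` C = {1..card ?B}" by simp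
  then show ?thesis using card_image[OF inj] by simp
qed

text \<open>\<open>id_on\<close> is injective and preserves and reflects order, so the count for
  vertex sets carries over.\<close>

lemma card_maxchain_idempotents:
  assumes C: "pred_on.maxchain (carrier (Tisg_idempotents G v)) (le (Tisg_idempotents G v)) C"
  shows "card C = card (component (verts G))"
proof -
  let ?L = "Tisg_idempotents G v"
  have ch: "pred_on.chain (carrier ?L) (le ?L) C"
    and no_ext: "\<And>S. pred_on.chain (carrier ?L) (le ?L) S \<Longrightarrow> \<not> C \<subset> S"
    using C by (auto simp: pred_on.maxchain_def)
  define D where "D = {X \<in> conn_sets. id_on X \<in> C}"
  have CD: "C = id_on ` D" using ch by (auto simp: pred_on.chain_def carrier_idempotents D_def)
  have chain: "X \<subseteq> Y \<or> Y \<subseteq> X" if "X \<in> D" "Y \<in> D" for X Y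
  proof -
    have "(le ?L)\<^sup>=\<^sup>= (id_on X) (id_on Y) \<or> (le ?L)\<^sup>=\<^sup>= (id_on Y) (id_on X)"
      using ch that unfolding pred_on.chain_def D_def by simp
    then show ?thesis using that by (auto simp: D_def le_idempotents id_on_eq_iff)
  qed
  have "card D = card (component (verts G))"
  proof (rule card_maxchain_conn_sets)
    show "D \<subseteq> conn_sets" by (auto simp: D_def)
    show "X \<subseteq> Y \<or> Y \<subseteq> X" if "X \<in> D" "Y \<in> D" for X Y by (rule chain[OF that])
    fix Z
    assume Z: "Z \<in> conn_sets" and comp: "\<And>X. X \<in> D \<Longrightarrow> X \<subseteq> Z \<or> Z \<subseteq> X"
    have sub: "insert Z D \<subseteq> conn_sets" using Z by (auto simp: D_def)
    have "X \<subseteq> Y \<or> Y \<subseteq> X" if "X \<in> insert Z D" "Y \<in> insert Z D" for X Y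
      using that comp chain by blast
    then have "(le ?L)\<^sup>=\<^sup>= (id_on X) (id_on Y) \<or> (le ?L)\<^sup>=\<^sup>= (id_on Y) (id_on X)"
      if "X \<in> insert Z D" "Y \<in> insert Z D" for X Y
      using that sub le_idempotents by (metis subsetD sup2I1)
    \<comment> \<open>Adding \<open>id_on Z\<close> to C still gives a chain, so maximality forces
      \<open>id_on Z\<close> into C.\<close>
    then have "pred_on.chain (carrier ?L) (le ?L) (id_on ` insert Z D)"
      unfolding pred_on.chain_def carrier_idempotents using sub by blast
    then have "\<not> C \<subset> id_on ` insert Z D" by (rule no_ext)
    then have "id_on Z \<in> C" using CD by blast
    then show "Z \<in> D" using Z by (simp add: D_def)
  qed
  moreover have "inj_on id_on D" by (auto simp: inj_on_def id_on_eq_iff)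
  ultimately show ?thesis by (simp add: CD card_image)
qed

lemma graded_lattice_idempotents: "graded_lattice (Tisg_idempotents G v)"
proof -
  \<comment> \<open>The component is nonempty, so its size has the form \<open>Suc n\<close>, with n
    the common length of the maximal chains.\<close>
  have "v \<in> component (verts G)" using root by (simp add: component_eq)
  moreover have "finite (component (verts G))"
    using component_subset[of "verts G"] finite_verts by (auto intro: finite_subset)
  ultimately obtain n where "card (component (verts G)) = Suc n"
    by (metis card_0_eq empty_iff not0_implies_Suc)
  then show ?thesis
    unfolding graded_lattice_def
    using lattice_idempotents card_maxchain_idempotents finite_conn_sets
    by (auto simp: carrier_idempotents)
qed

end

theorem theorem3p4:
  fixes G :: "('v, 'e) mgraph" and v :: 'v
  assumes "finite_graph G" and "v \<in> verts G"
  shows "graded_lattice (Tisg_idempotents G v)"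
proof -
  interpret rooted_graph G v by unfold_locales (fact assms)+
  show ?thesis by (rule graded_lattice_idempotents)
qed

end
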